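(* Let $W$ be a finite nonempty index set, and let $m,n,p,s$ and $k_w$ ($w\in W$) be nonnegative integers. Let $c_I\in\mathbb{R}^m$, $R\in\mathbb{R}^{s\times m}$, $r\in\mathbb{R}^s$, $e\in\mathbb{R}^p$, and for each $w\in W$ let $c_w\in\mathbb{R}^n$, $A_w\in\mathbb{R}^{k_w\times n}$, $B_w\in\mathbb{R}^{k_w\times m}$, $b_w\in\mathbb{R}^{k_w}$, $Q_w\in\mathbb{R}^{p\times n}$. Consider the mixed integer linear program (P) in the variables $y$ and $(x_w)_{w\in W}$ with $x_w\in\mathbb{R}^n$: $$\begin{aligned}\text{minimize}\quad & c_I^T y+\sum_{w\in W}c_w^T x_w\\ \text{subject to}\quad & A_w x_w+B_w y\le b_w,\quad \forall w\in W,\\ & \sum_{w\in W}Q_w x_w\le e,\\ & R y\le r,\\ & x_w\ge 0,\quad \forall w\in W,\\ & y\ge 0,\quad y\in\mathbb{Z}^m,\end{aligned}$$ and the mixed integer linear program (P') in the variables $y$, $(x_w)_{w\in W}$ and $(q_w)_{w\in W}$ with $x_w\in\mathbb{R}^n$, $q_w\in\mathbb{R}^p$: $$\begin{aligned}\text{minimize}\quad & c_I^T y+\sum_{w\in W}c_w^T x_w\\ \text{subject to}\quad & A_w x_w+B_w y\le b_w,\quad \forall w\in W,\\ & Q_w x_w\le q_w,\quad \forall w\in W,\\ & \sum_{w\in W}q_w=e,\\ & R y\le r,\\ & x_w\ge 0,\quad \forall w\in W,\\ & y\ge 0,\quad y\in\mathbb{Z}^m.\end{aligned}$$ Then (P)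 is equivalent to (P'): a point $(y,(x_w)_{w\in W})$ is feasible for (P) if and only if there exist vectors $(q_w)_{w\in W}$ in $\mathbb{R}^p$ such that $(y,(x_w)_{w\in W},(q_w)_{w\in W})$ is feasible for (P'), and the objective values of the two points in their respective problems coincide.
   Context: All vector inequalities $u\le v$ (and $u\ge 0$) are understood component-wise. The variables $q_w$ ("budgeting variables") in (P') are unrestricted in sign. In the source application, $W$ indexes operational subperiods (e.g. weeks), $y$ collects investment decisions, $x_w$ collects operational decisions in subperiod $w$, and the constraint $\sum_{w\in W} Q_w x_w\le e$ represents policy constraints coupling all subperiods. *)

theory Defs
  imports "Jordan_Normal_Form.Matrix"
begin

text \<open>
  The decision variables \<open>x\<close> (and \<open>q\<close>) are families of vectors indexed by \<open>W\<close>; they are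
  functions on the whole index type whose values outside \<open>W\<close> are never looked at.
  The order on vectors is the component-wise one of the library, which in particular
  requires equal dimensions.
\<close>

definition feasible_P ::
  "'w set \<Rightarrow> nat \<Rightarrow> nat \<Rightarrow> nat \<Rightarrow>
   ('w \<Rightarrow> real mat) \<Rightarrow> ('w \<Rightarrow> real mat) \<Rightarrow> ('w \<Rightarrow> real vec) \<Rightarrow> ('w \<Rightarrow> real mat) \<Rightarrow>
   real vec \<Rightarrow> real mat \<Rightarrow> real vec \<Rightarrow> real vec \<Rightarrow> ('w \<Rightarrow> real vec) \<Rightarrow> bool"
where
  "feasible_P W m n p A B b Q e R r y x \<longleftrightarrow>
     y \<in> carrier_vec m \<and> (\<forall>w\<in>W. x w \<in> carrier_vec n) \<and>
     (\<forall>w\<in>W. A w *\<^sub>v x w + B w *\<^sub>v y \<le> b w) \<and>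
     finsum_vec TYPE(real) p (\<lambda>w. Q w *\<^sub>v x w) W \<le> e \<and>
     R *\<^sub>v y \<le> r \<and>
     (\<forall>w\<in>W. 0\<^sub>v n \<le> x w) \<and>
     0\<^sub>v m \<le> y \<and> (\<forall>i<m. y $ i \<in> \<int>)"

definition objective_P ::
  "'w set \<Rightarrow> real vec \<Rightarrow> ('w \<Rightarrow> real vec) \<Rightarrow> real vec \<Rightarrow> ('w \<Rightarrow> real vec) \<Rightarrow> real"
where
  "objective_P W c\<^sub>I c y x = c\<^sub>I \<bullet> y + (\<Sum>w\<in>W. c w \<bullet> x w)"

definition feasible_P' ::
  "'w set \<Rightarrow> nat \<Rightarrow> nat \<Rightarrow> nat \<Rightarrow>
   ('w \<Rightarrow> real mat) \<Rightarrow> ('w \<Rightarrow> real mat) \<Rightarrow> ('w \<Rightarrow> real vec) \<Rightarrow> ('w \<Rightarrow> real mat) \<Rightarrow>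
   real vec \<Rightarrow> real mat \<Rightarrow> real vec \<Rightarrow>
   real vec \<Rightarrow> ('w \<Rightarrow> real vec) \<Rightarrow> ('w \<Rightarrow> real vec) \<Rightarrow> bool"
where
  "feasible_P' W m n p A B b Q e R r y x q \<longleftrightarrow>
     y \<in> carrier_vec m \<and> (\<forall>w\<in>W. x w \<in> carrier_vec n) \<and> (\<forall>w\<in>W. q w \<in> carrier_vec p) \<and>
     (\<forall>w\<in>W. A w *\<^sub>v x w + B w *\<^sub>v y \<le> b w) \<and>
     (\<forall>w\<in>W. Q w *\<^sub>v x w \<le> q w) \<and>
     finsum_vec TYPE(real) p q W = e \<and>
     R *\<^sub>v y \<le> r \<and>
     (\<forall>w\<in>W. 0\<^sub>v n \<le> x w) \<and>
     0\<^sub>v m \<le> y \<and> (\<forall>i<m. y $ i \<in> \<int>)"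

definition objective_P' ::
  "'w set \<Rightarrow> real vec \<Rightarrow> ('w \<Rightarrow> real vec) \<Rightarrow>
   real vec \<Rightarrow> ('w \<Rightarrow> real vec) \<Rightarrow> ('w \<Rightarrow> real vec) \<Rightarrow> real"
where
  "objective_P' W c\<^sub>I c y x q = c\<^sub>I \<bullet> y + (\<Sum>w\<in>W. c w \<bullet> x w)"

end

theory Submission
  imports Defs
begin

text \<open>(P) is the projection of (P') along the budgets \<open>q\<close>. All constraints other
  than the coupling one are shared, so only that one matters. If each
  \<open>Q w *\<^sub>v x w\<close> stays within its budget and the budgets add up to
  \<open>e\<close>, summation gives the coupling constraint (\<open>finsum_vec_mono\<close>).
  Conversely, the usages \<open>Q w *\<^sub>v x w\<close> are themselves budgets with total at most
  \<open>e\<close>; raising one of them by the nonnegative slack makes the total exactly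
  \<open>e\<close> (\<open>finsum_vec_le_imp_budget\<close>).\<close>

lemma finsum_vec_dim:
  assumes "f \<in> W \<rightarrow> carrier_vec p"
  shows "dim_vec (finsum_vec TYPE('a :: comm_monoid_add) p f W) = p"
  using finsum_vec_closed[OF assms] by simp

text \<open>Monotonicity of finite sums, applied in each component. The vector order also demands
  equal dimensions; both sums have dimension \<open>p\<close>.\<close>

lemma finsum_vec_mono:
  fixes f g :: "'w \<Rightarrow> 'a :: ordered_comm_monoid_add vec"
  assumes "finite W"
    and f: "f \<in> W \<rightarrow> carrier_vec p"
    and g: "g \<in> W \<rightarrow> carrier_vec p"
    and le: "\<And>w. w \<in> W \<Longrightarrow> f w \<le> g w"
  shows "finsum_vec TYPE('a) p f W \<le> finsum_vec TYPE('a) p g W"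
proof -
  have "(\<Sum>w\<in>W. f w $ i) \<le> (\<Sum>w\<in>W. g w $ i)" if "i < p" for i
  proof (rule sum_mono)
    fix w assume "w \<in> W"
    then show "f w $ i \<le> g w $ i"
      using le[of w] funcset_mem[OF g, of w] that by (simp add: less_eq_vec_def)
  qed
  then show ?thesis
    using \<open>finite W\<close> f g by (simp add: less_eq_vec_def index_finsum_vec finsum_vec_dim)
qed

text \<open>The whole slack of the aggregate inequality is given to one arbitrary index.\<close>

lemma finsum_vec_le_imp_budget:
  fixes f :: "'w \<Rightarrow> 'a :: ordered_ab_group_add vec"
  assumes "finite W" and "W \<noteq> {}"
    and f: "f \<in> W \<rightarrow> carrier_vec p"
    and e: "e \<in> carrier_vec p"
    and le: "finsum_vec TYPE('a) p f W \<le> e"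
  shows "\<exists>q \<in> W \<rightarrow> carrier_vec p.
    (\<forall>w\<in>W. f w \<le> q w) \<and> finsum_vec TYPE('a) p q W = e"
proof -
  obtain u where u: "u \<in> W" using \<open>W \<noteq> {}\<close> by auto
  define S where "S i = (\<Sum>w\<in>W. f w $ i)" for i
  \<comment> \<open>Every index other than \<open>u\<close> gets a tight budget.\<close>
  define q where "q w = vec p (\<lambda>i. f w $ i + (if w = u then e $ i - S i else 0))" for w
  have q: "q \<in> W \<rightarrow> carrier_vec p"
    by (simp add: q_def)
  \<comment> \<open>The slack is nonnegative, so the budget at \<open>u\<close> still dominates
    \<open>f u\<close>.\<close>
  have S_le: "S i \<le> e $ i" if "i < p" for i
    using le that e \<open>finite W\<close> f by (auto simp: less_eq_vec_def index_finsum_vec S_def)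
  show ?thesis
  proof (intro bexI[of _ q] conjI ballI q)
    show "f w \<le> q w" if "w \<in> W" for w
      using funcset_mem[OF f that] S_le by (auto simp: q_def less_eq_vec_def)
    show "finsum_vec TYPE('a) p q W = e"
    proof (rule eq_vecI)
      show "dim_vec (finsum_vec TYPE('a) p q W) = dim_vec e"
        using finsum_vec_dim[OF q] e by simp
      fix i assume "i < dim_vec e"
      then have i: "i < p" using e by simp
      have "finsum_vec TYPE('a) p q W $ i = (\<Sum>w\<in>W. q w $ i)"
        using \<open>finite W\<close> q i by (simp add: index_finsum_vec)
      also have "\<dots> = S i + (\<Sum>w\<in>W. if w = u then e $ i - S i else 0)"
        using i by (simp add: q_def S_def sum.distrib)
      \<comment> \<open>Only the term at \<open>u\<close> survives in the second sum, and it cancels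
        \<open>S i\<close>.\<close>
      also have "\<dots> = e $ i"
        using \<open>finite W\<close> u by simp
      finally show "finsum_vec TYPE('a) p q W $ i = e $ i" .
    qed
  qed
qed

theorem theorem1:
  fixes W :: "'w set" and m n p s :: nat and k :: "'w \<Rightarrow> nat"
    and c\<^sub>I :: "real vec" and R :: "real mat" and r e :: "real vec"
    and c :: "'w \<Rightarrow> real vec" and A B :: "'w \<Rightarrow> real mat"
    and b :: "'w \<Rightarrow> real vec" and Q :: "'w \<Rightarrow> real mat"
    and y :: "real vec" and x :: "'w \<Rightarrow> real vec"
  assumes "finite W" and "W \<noteq> {}"
    and "c\<^sub>I \<in> carrier_vec m"
    and "R \<in> carrier_mat s m"
    and "r \<in> carrier_vec s"
    and "e \<in> carrier_vec p"
    and "\<And>w. w \<in> W \<Longrightarrow> c w \<in> carrier_vec n"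
    and "\<And>w. w \<in> W \<Longrightarrow> A w \<in> carrier_mat (k w) n"
    and "\<And>w. w \<in> W \<Longrightarrow> B w \<in> carrier_mat (k w) m"
    and "\<And>w. w \<in> W \<Longrightarrow> b w \<in> carrier_vec (k w)"
    and "\<And>w. w \<in> W \<Longrightarrow> Q w \<in> carrier_mat p n"
  shows "(feasible_P W m n p A B b Q e R r y x \<longleftrightarrow>
            (\<exists>q. feasible_P' W m n p A B b Q e R r y x q)) \<and>
         (\<forall>q. feasible_P' W m n p A B b Q e R r y x q \<longrightarrow>
            objective_P' W c\<^sub>I c y x q = objective_P W c\<^sub>I c y x)"
proof -
  \<comment> \<open>The dimension of the product is the row count of \<open>Q w\<close>, so this is
    available in both directions.\<close>
  have Qx: "(\<lambda>w. Q w *\<^sub>v x w) \<in> W \<rightarrow> carrier_vec p"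
    by (intro funcsetI carrier_vecI) (simp add: carrier_matD(1)[OF assms(11)])
  have "\<exists>q. feasible_P' W m n p A B b Q e R r y x q"
    if P: "feasible_P W m n p A B b Q e R r y x"
  proof -
    have "finsum_vec TYPE(real) p (\<lambda>w. Q w *\<^sub>v x w) W \<le> e"
      using P by (simp add: feasible_P_def)
    from finsum_vec_le_imp_budget[OF assms(1,2) Qx assms(6) this]
    obtain q where "q \<in> W \<rightarrow> carrier_vec p" "\<forall>w\<in>W. Q w *\<^sub>v x w \<le> q w"
      "finsum_vec TYPE(real) p q W = e"
      by blast
    with P have "feasible_P' W m n p A B b Q e R r y x q"
      unfolding feasible_P_def feasible_P'_def Pi_iff by blast
    then show ?thesis by blast
  qed
  moreover have "feasible_P W m n p A B b Q e R r y x"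
    if P': "feasible_P' W m n p A B b Q e R r y x q" for q
  proof -
    have q: "q \<in> W \<rightarrow> carrier_vec p" and "\<And>w. w \<in> W \<Longrightarrow> Q w *\<^sub>v x w \<le> q w"
      using P' unfolding feasible_P'_def by blast+
    from finsum_vec_mono[OF assms(1) Qx this]
    have "finsum_vec TYPE(real) p (\<lambda>w. Q w *\<^sub>v x w) W \<le> finsum_vec TYPE(real) p q W" .
    with P' show ?thesis
      unfolding feasible_P_def feasible_P'_def by simp
  qed
  ultimately show ?thesis
    \<comment> \<open>Both objectives unfold to the same expression in \<open>y\<close> and
      \<open>x\<close>.\<close>
    by (auto simp: objective_P_def objective_P'_def)
qed

end
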